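(* The recursive-line Zarankiewicz number $z_{RL}$ satisfies $z_{RL}(15,6)=60$.
   Context: **Grids.** Let $m,n\ge 2$ and let the cells be the elements $(i,j)$ of $\{1,\dots,m\}\times\{1,\dots,n\}$ ($i$ is the row, $j$ the column). A grid consists of a set $E_1$ of cells (the one-edges) and a set $E_2$ of unordered pairs of distinct cells (the two-edges, or double edges). The selected edges are the elements of $E_1$ and of $E_2$; a one-edge occupies one cell, a two-edge occupies its two cells. The grid is simple if every cell is occupied by at most one selected edge. Cells occupied by no selected edge are empty. A two-edge may have its two cells in the same row (row-degenerate), in the same column (column-degenerate), or in different rows and different columns (diagonal). The total of the grid is $N=|E_1|+|E_2|$ (a two-edge counts once). A simple grid corresponds to the doubly simple biquadratic form $\sum_{(i,j)\in E_1}x_i^2y_j^2+\sum_{\{(i,j),(k,l)\}\in E_2}(x_iy_j+x_ky_l)^2$. **Zarankiewicz number.** $z(m,n)$ is the maximum number of ones in an $m\times n$ binary matrix with no all-one $2\times2$ submatrix. A grid is limited if $|E_1|=z(m,n)$. **Rectangles.** For rows $i\neq k$ and columns $j\ne l$, the rectangle on these rows and columns has the two diagonals $\{(i,j),(k,l)\}$ and $\{(i,l),(k,j)\}$. **Certification $(\mathrm{RW}3^+)$.** For a simple grid, let $I\subseteq E_2$ (the identified two-edges) and $Z$ (a set of unordered pairs of distinct cells, the certified orthogonal pairs) be the smallest sets closed under the following rules. (1) Every pair containing an empty cell is in $Z$. (2) Line rule: if two distinct cells lie in the same row or the same column, then the pair is in $I$ if it is a two-edge, and is in $Z$ otherwise.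 (3) Complementary-pair rule: if both diagonals of a rectangle are two-edges, both are in $I$. (4) Rectangle transfer: if neither diagonal of a rectangle is a two-edge and one diagonal is in $Z$, then the other is in $Z$. If exactly one diagonal $d$ of a rectangle is a two-edge and $d'$ is the other diagonal, then $d'\in Z$ implies $d\in I$, and $d\in I$ implies $d'\in Z$. (5) Saturation: if $\{a,a'\}\in I$, $c\notin\{a,a'\}$ and $\{a,c\}\in Z$, then $\{a',c\}\in Z$. The grid satisfies $(\mathrm{RW}3^+)$ if $I=E_2$ and, for every two distinct selected edges $e,f$, all pairs consisting of a cell of $e$ and a cell of $f$ are in $Z$. (Identification only glues the two halves of a single two-edge, so distinct selected edges give distinct classes.) **Recursive-line Zarankiewicz number.** $z_{RL}(m,n)$ is the maximum of $|E_1|+|E_2|$ over all simple, limited $m\times n$ grids satisfying $(\mathrm{RW}3^+)$. *)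

theory Defs
  imports Main
begin

type_synonym cell = "nat \<times> nat"

definition cells :: "nat \<Rightarrow> nat \<Rightarrow> cell set" where
  "cells m n = {1..m} \<times> {1..n}"

definition is_grid :: "nat \<Rightarrow> nat \<Rightarrow> cell set \<Rightarrow> cell set set \<Rightarrow> bool" where
  "is_grid m n E1 E2 \<longleftrightarrow> E1 \<subseteq> cells m n \<and> (\<forall>p\<in>E2. p \<subseteq> cells m n \<and> card p = 2)"

(* A selected edge is represented by the set of cells it occupies: a singleton for a
   one-edge, a two-element set for a two-edge.  The cardinality keeps the two kinds apart. *)
definition selected_edges :: "cell set \<Rightarrow> cell set set \<Rightarrow> cell set set" where
  "selected_edges E1 E2 = (\<lambda>c. {c}) ` E1 \<union> E2"

definition simple_grid :: "nat \<Rightarrow> nat \<Rightarrow> cell set \<Rightarrow> cell set set \<Rightarrow> bool" where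
  "simple_grid m n E1 E2 \<longleftrightarrow> is_grid m n E1 E2 \<and>
     (\<forall>c \<in> cells m n. \<forall>e \<in> selected_edges E1 E2. \<forall>f \<in> selected_edges E1 E2.
        c \<in> e \<longrightarrow> c \<in> f \<longrightarrow> e = f)"

definition empty_cells :: "nat \<Rightarrow> nat \<Rightarrow> cell set \<Rightarrow> cell set set \<Rightarrow> cell set" where
  "empty_cells m n E1 E2 = cells m n - \<Union> (selected_edges E1 E2)"

(* An m x n binary matrix is represented by the set S of positions of its ones. *)
definition no_all_one_2x2 :: "cell set \<Rightarrow> bool" where
  "no_all_one_2x2 S \<longleftrightarrow>
     \<not> (\<exists>i k j l. i \<noteq> k \<and> j \<noteq> l \<and> (i, j) \<in> S \<and> (i, l) \<in> S \<and> (k, j) \<in> S \<and> (k, l) \<in> S)"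

definition zarankiewicz :: "nat \<Rightarrow> nat \<Rightarrow> nat" where
  "zarankiewicz m n = Max {card S | S. S \<subseteq> cells m n \<and> no_all_one_2x2 S}"

definition limited :: "nat \<Rightarrow> nat \<Rightarrow> cell set \<Rightarrow> bool" where
  "limited m n E1 \<longleftrightarrow> card E1 = zarankiewicz m n"

definition same_line :: "cell \<Rightarrow> cell \<Rightarrow> bool" where
  "same_line a b \<longleftrightarrow> fst a = fst b \<or> snd a = snd b"

definition rectangle :: "nat \<Rightarrow> nat \<Rightarrow> nat \<Rightarrow> nat \<Rightarrow> nat \<Rightarrow> nat \<Rightarrow> bool" where
  "rectangle m n i k j l \<longleftrightarrow> i \<in> {1..m} \<and> k \<in> {1..m} \<and> i \<noteq> k \<and> j \<in> {1..n} \<and> l \<in> {1..n} \<and> j \<noteq> l"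

(* identified is the set I, certified is the set Z.  The roles of the two diagonals in the
   transfer rules are interchanged by exchanging j and l, so one orientation suffices. *)
inductive_set
      identified :: "nat \<Rightarrow> nat \<Rightarrow> cell set \<Rightarrow> cell set set \<Rightarrow> cell set set"
  and certified :: "nat \<Rightarrow> nat \<Rightarrow> cell set \<Rightarrow> cell set set \<Rightarrow> cell set set"
  for m n :: nat and E1 :: "cell set" and E2 :: "cell set set"
where
  empty_pair:
    "\<lbrakk>a \<in> empty_cells m n E1 E2; b \<in> cells m n; a \<noteq> b\<rbrakk>
      \<Longrightarrow> {a, b} \<in> certified m n E1 E2"
| line_identified:
    "\<lbrakk>a \<in> cells m n; b \<in> cells m n; a \<noteq> b; same_line a b; {a, b} \<in> E2\<rbrakk>
      \<Longrightarrow> {a, b} \<in> identified m n E1 E2"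
| line_certified:
    "\<lbrakk>a \<in> cells m n; b \<in> cells m n; a \<noteq> b; same_line a b; {a, b} \<notin> E2\<rbrakk>
      \<Longrightarrow> {a, b} \<in> certified m n E1 E2"
| complementary_pair:
    "\<lbrakk>rectangle m n i k j l; {(i, j), (k, l)} \<in> E2; {(i, l), (k, j)} \<in> E2\<rbrakk>
      \<Longrightarrow> {(i, j), (k, l)} \<in> identified m n E1 E2"
| transfer_none:
    "\<lbrakk>rectangle m n i k j l; {(i, j), (k, l)} \<notin> E2; {(i, l), (k, j)} \<notin> E2;
      {(i, j), (k, l)} \<in> certified m n E1 E2\<rbrakk>
      \<Longrightarrow> {(i, l), (k, j)} \<in> certified m n E1 E2"
| transfer_identified:
    "\<lbrakk>rectangle m n i k j l; {(i, j), (k, l)} \<in> E2; {(i, l), (k, j)} \<notin> E2;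
      {(i, l), (k, j)} \<in> certified m n E1 E2\<rbrakk>
      \<Longrightarrow> {(i, j), (k, l)} \<in> identified m n E1 E2"
| transfer_certified:
    "\<lbrakk>rectangle m n i k j l; {(i, j), (k, l)} \<in> E2; {(i, l), (k, j)} \<notin> E2;
      {(i, j), (k, l)} \<in> identified m n E1 E2\<rbrakk>
      \<Longrightarrow> {(i, l), (k, j)} \<in> certified m n E1 E2"
| saturation:
    "\<lbrakk>{a, a'} \<in> identified m n E1 E2; c \<notin> {a, a'}; {a, c} \<in> certified m n E1 E2\<rbrakk>
      \<Longrightarrow> {a', c} \<in> certified m n E1 E2"

definition RW3_plus :: "nat \<Rightarrow> nat \<Rightarrow> cell set \<Rightarrow> cell set set \<Rightarrow> bool" where
  "RW3_plus m n E1 E2 \<longleftrightarrow> identified m n E1 E2 = E2 \<and>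
     (\<forall>e \<in> selected_edges E1 E2. \<forall>f \<in> selected_edges E1 E2. e \<noteq> f \<longrightarrow>
        (\<forall>a \<in> e. \<forall>b \<in> f. {a, b} \<in> certified m n E1 E2))"

definition z_RL :: "nat \<Rightarrow> nat \<Rightarrow> nat" where
  "z_RL m n = Max {card E1 + card E2 | E1 E2.
     simple_grid m n E1 E2 \<and> limited m n E1 \<and> RW3_plus m n E1 E2}"

end

theory Submission imports Defs begin

text \<open>
  The upper bound is pure counting. In a matrix without an all-one \<open>2 \<times> 2\<close> submatrix no pair of
  columns is used by two rows, so rows with \<open>r\<^sub>1, \<dots>, r\<^sub>m\<close> ones satisfy
  \<open>\<Sum> (r\<^sub>i choose 2) \<le> n choose 2\<close>, and \<open>r \<le> 1 + (r choose 2)\<close> gives at most \<open>m + (n choose 2)\<close> ones.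
  For \<open>15 \<times> 6\<close> this is \<open>30\<close>, attained by the incidence matrix of the complete graph \<open>K\<^sub>6\<close>, whose
  edges are the rows and whose vertices are the columns. Thus a limited grid has \<open>30\<close> one-edges; the
  other \<open>60\<close> cells hold at most \<open>30\<close> two-edges, and the total is at most \<open>60\<close>
  (\<open>simple_grid_card_le\<close>).

  Equality needs a perfect matching of the \<open>60\<close> cells off the incidence matrix for which the
  certification rules reach everything. In the matching used here, twenty two-edges are identified
  without any certified pair: ten are row-degenerate and the other ten are the diagonals of five
  rectangles. Five more are identified by rectangle transfers that rely on gluing only along these
  twenty, and the last five by transfers that rely on gluing along the first twenty-five.

  Once all two-edges are identified, the rules say that a pair of cells may be replaced by the opposite
  diagonal of its rectangle, provided that neither diagonal is a two-edge, and that either cell of a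
  pair may be replaced by its partner in the matching. Each replacement preserves being certified in
  both directions. A pair is therefore certified if some chain of replacements leads from it to a pair
  on a common line, or to a pair opposite to an identified two-edge. A depth-bounded search
  (\<open>reaches_line\<close>, sound by \<open>certified_of_reaches_line\<close>) finds such a chain of at most six gluings for
  every pair of cells in different rows that is not a two-edge (\<open>all_reach_line\<close>).
\<close>

section \<open>Upper bounds by counting\<close>

lemma finite_cells [simp]: "finite (cells m n)"
  by (simp add: cells_def)

lemma card_cells [simp]: "card (cells m n) = m * n"
  by (simp add: cells_def)

lemma le_Suc_choose_two: "r \<le> Suc (r choose 2)"
proof (cases r)
  case (Suc s)
  then have "r choose 2 = s + (s choose 2)"
    by (simp add: numeral_2_eq_2)
  then show ?thesis using Suc by simp
qed simp

text \<open>
  Two rows sharing a pair of columns would span an all-one \<open>2 \<times> 2\<close> submatrix, so the sets of column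
  pairs inside the rows are disjoint; summing \<open>le_Suc_choose_two\<close> over the rows gives the bound.
\<close>

lemma card_no_all_one_2x2_le:
  assumes S: "S \<subseteq> cells m n" and no: "no_all_one_2x2 S"
  shows "card S \<le> m + (n choose 2)"
proof -
  define row where "row i = {j. (i, j) \<in> S}" for i
  define prs where "prs i = {P. P \<subseteq> row i \<and> card P = 2}" for i
  have row_sub: "row i \<subseteq> {1..n}" for i
    using S by (auto simp: row_def cells_def)
  then have fin_row: "finite (row i)" for i
    using finite_subset by blast
  have S_eq: "S = (SIGMA i:{1..m}. row i)"
    using S by (auto simp: row_def cells_def)
  have fin_prs: "finite (prs i)" for i
    using fin_row by (simp add: prs_def)
  have disj: "prs i \<inter> prs k = {}" if "i \<noteq> k" for i k
  proof (rule ccontr)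
    assume "prs i \<inter> prs k \<noteq> {}"
    then obtain P where P: "P \<subseteq> row i" "P \<subseteq> row k" "card P = 2"
      by (auto simp: prs_def)
    then obtain j l where "P = {j, l}" "j \<noteq> l"
      by (meson card_2_iff)
    with P that no show False
      by (auto simp: row_def no_all_one_2x2_def)
  qed
  have "(\<Sum>i\<in>{1..m}. card (row i) choose 2) = (\<Sum>i\<in>{1..m}. card (prs i))"
    using fin_row by (simp add: prs_def n_subsets)
  also have "\<dots> = card (\<Union>i\<in>{1..m}. prs i)"
    using fin_prs disj by (simp add: card_UN_disjoint)
  also have "\<dots> \<le> card {P. P \<subseteq> {1..n} \<and> card P = 2}"
    using row_sub by (intro card_mono) (auto simp: prs_def)
  also have "\<dots> = n choose 2"
    by (simp add: n_subsets)
  finally have choose: "(\<Sum>i\<in>{1..m}. card (row i) choose 2) \<le> n choose 2" .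
  have "card S = (\<Sum>i\<in>{1..m}. card (row i))"
    unfolding S_eq using fin_row by (simp add: card_SigmaI)
  also have "\<dots> \<le> (\<Sum>i\<in>{1..m}. 1 + (card (row i) choose 2))"
    using le_Suc_choose_two by (intro sum_mono) simp
  also have "\<dots> = m + (\<Sum>i\<in>{1..m}. card (row i) choose 2)"
    unfolding sum.distrib by simp
  finally show ?thesis using choose by simp
qed

lemma zarankiewicz_eqI:
  assumes "S \<subseteq> cells m n" "no_all_one_2x2 S" "card S = m + (n choose 2)"
  shows "zarankiewicz m n = card S"
  unfolding zarankiewicz_def
proof (rule Max_eqI)
  have "{card T |T. T \<subseteq> cells m n \<and> no_all_one_2x2 T} \<subseteq> card ` Pow (cells m n)"
    by auto
  then show "finite {card T |T. T \<subseteq> cells m n \<and> no_all_one_2x2 T}"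
    by (rule finite_subset) simp
  show "card S \<in> {card T |T. T \<subseteq> cells m n \<and> no_all_one_2x2 T}"
    using assms by blast
qed (use assms(3) card_no_all_one_2x2_le in auto)

text \<open>In a simple grid the occupied cells can be counted edge by edge.\<close>

lemma simple_grid_card_le:
  assumes "simple_grid m n E1 E2"
  shows "card E1 + 2 * card E2 \<le> m * n"
proof -
  have E1: "E1 \<subseteq> cells m n" and E2: "\<And>p. p \<in> E2 \<Longrightarrow> p \<subseteq> cells m n \<and> card p = 2"
    using assms by (auto simp: simple_grid_def is_grid_def)
  have eq: "e = f" if "c \<in> e" "c \<in> f" "e \<in> selected_edges E1 E2" "f \<in> selected_edges E1 E2" for c e f
  proof -
    have "c \<in> cells m n"
      using that E1 E2 by (auto simp: selected_edges_def)
    with that assms show ?thesis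
      by (auto simp: simple_grid_def)
  qed
  have fin: "finite E1" "finite (\<Union>E2)"
    using E1 E2 by (meson finite_cells finite_subset Union_least)+
  have "card (\<Union>E2) = sum card E2"
  proof (rule card_Union_disjoint)
    show "pairwise disjnt E2"
      using eq by (auto simp: pairwise_def disjnt_def selected_edges_def)
    show "finite p" if "p \<in> E2" for p
      using E2[OF that] finite_cells finite_subset by blast
  qed
  then have U: "card (\<Union>E2) = 2 * card E2"
    using E2 by simp
  have "E1 \<inter> \<Union>E2 = {}"
  proof (rule ccontr)
    assume "E1 \<inter> \<Union>E2 \<noteq> {}"
    then obtain c p where "c \<in> E1" "c \<in> p" "p \<in> E2" by auto
    then have "{c} = p"
      using eq by (auto simp: selected_edges_def)
    with E2 \<open>p \<in> E2\<close> show False by force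
  qed
  then have "card E1 + card (\<Union>E2) = card (E1 \<union> \<Union>E2)"
    using fin by (simp add: card_Un_disjoint)
  also have "\<dots> \<le> card (cells m n)"
    using E1 E2 by (intro card_mono) auto
  finally show ?thesis using U by simp
qed

section \<open>Grids given by a list of disjoint pairs\<close>

definition endpoints :: "(cell \<times> cell) list \<Rightarrow> cell list" where
  "endpoints es = map fst es @ map snd es"

definition doubles :: "(cell \<times> cell) list \<Rightarrow> cell set set" where
  "doubles es = (\<lambda>(a, b). {a, b}) ` set es"

definition singles :: "nat \<Rightarrow> nat \<Rightarrow> (cell \<times> cell) list \<Rightarrow> cell set" where
  "singles m n es = cells m n - set (endpoints es)"

text \<open>
  The involution that exchanges the two cells of each listed pair and fixes every other cell. In this
  form both membership in a two-edge and gluing along it become rewriting steps.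
\<close>

definition partner :: "(cell \<times> cell) list \<Rightarrow> cell \<Rightarrow> cell" where
  "partner es c = (case map_of (es @ map prod.swap es) c of None \<Rightarrow> c | Some d \<Rightarrow> d)"

lemma partner_outside:
  assumes "c \<notin> set (endpoints es)"
  shows "partner es c = c"
proof -
  have "map_of (es @ map prod.swap es) c = None"
    using assms by (force simp: endpoints_def map_of_eq_None_iff map_add_None)
  then show ?thesis by (simp add: partner_def del: map_of_append)
qed

lemma partner_inside:
  assumes "distinct (endpoints es)" "(a, b) \<in> set es"
  shows "partner es a = b" "partner es b = a"
proof -
  let ?xs = "es @ map prod.swap es"
  have "distinct (map fst ?xs)"
    using assms(1) by (simp add: endpoints_def comp_def)
  moreover have "(a, b) \<in> set ?xs" "(b, a) \<in> set ?xs"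
    using assms(2) by force+
  ultimately have "map_of ?xs a = Some b" "map_of ?xs b = Some a"
    by (simp_all add: map_of_is_SomeI del: map_of_append)
  then show "partner es a = b" "partner es b = a"
    by (simp_all add: partner_def del: map_of_append)
qed

text \<open>
  One rewrite rule per cell, so that evaluating \<^const>\<open>partner\<close> never searches the list. The function
  is passed as \<open>p\<close> so that the list inside it stays folded when the lists \<open>es\<close> and \<open>cs\<close> are expanded.
\<close>

lemma partner_table:
  assumes "p = partner es" "distinct (endpoints es @ cs)"
  shows "list_all (\<lambda>(a, b). p a = b \<and> p b = a) es"
    and "list_all (\<lambda>c. p c = c) cs"
  using assms partner_inside[of es] by (auto simp: list_all_iff intro!: partner_outside)

locale disjoint_pairs =
  fixes m n :: nat and es :: "(cell \<times> cell) list"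
  assumes dist: "distinct (endpoints es)" and in_cells: "set (endpoints es) \<subseteq> cells m n"
begin

lemma pair_neq: "(a, b) \<in> set es \<Longrightarrow> a \<noteq> b"
  using dist by (force simp: endpoints_def)

lemma partner_cases:
  obtains "partner es c = c" | "(c, partner es c) \<in> set es" | "(partner es c, c) \<in> set es"
proof (cases "c \<in> set (endpoints es)")
  case True
  then obtain a b where "(a, b) \<in> set es" "c = a \<or> c = b"
    by (auto simp: endpoints_def)
  then show ?thesis
    using partner_inside[OF dist, of a b] that by auto
qed (use partner_outside that in blast)

lemma partner_partner: "partner es (partner es c) = c"
proof (rule partner_cases[of c])
  assume "(c, partner es c) \<in> set es"
  then show ?thesis by (rule partner_inside(2)[OF dist])
next
  assume "(partner es c, c) \<in> set es"
  then show ?thesis by (rule partner_inside(1)[OF dist])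
qed simp

lemma endpoints_in_cells:
  assumes "(a, b) \<in> set es"
  shows "a \<in> cells m n" "b \<in> cells m n"
  using assms in_cells by (force simp: endpoints_def)+

lemma partner_in_cells: "c \<in> cells m n \<Longrightarrow> partner es c \<in> cells m n"
  using partner_cases[of c] endpoints_in_cells by metis

lemma doubles_iff: "{a, b} \<in> doubles es \<longleftrightarrow> a \<noteq> b \<and> partner es a = b"
proof
  assume "{a, b} \<in> doubles es"
  then obtain x y where "(x, y) \<in> set es" "{a, b} = {x, y}"
    by (auto simp: doubles_def)
  moreover have "x \<noteq> y" "partner es x = y" "partner es y = x"
    using \<open>(x, y) \<in> set es\<close> pair_neq partner_inside[OF dist] by auto
  ultimately show "a \<noteq> b \<and> partner es a = b"
    by (auto simp: doubleton_eq_iff)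
next
  assume ab: "a \<noteq> b \<and> partner es a = b"
  then have "(a, b) \<in> set es \<or> (b, a) \<in> set es"
    using partner_cases[of a] by metis
  then show "{a, b} \<in> doubles es"
    by (auto simp: doubles_def insert_commute intro: rev_image_eqI)
qed

lemma card_doubles: "card (doubles es) = length es"
proof -
  have disj: "fst ` set es \<inter> snd ` set es = {}" and "distinct es"
    using dist by (auto simp: endpoints_def distinct_map)
  have "inj_on (\<lambda>(a, b). {a, b}) (set es)"
  proof (rule inj_onI, clarify)
    fix a b c d
    assume ab: "(a, b) \<in> set es" and cd: "(c, d) \<in> set es" and "{a, b} = {c, d}"
    then consider "a = c" "b = d" | "a = d"
      by (auto simp: doubleton_eq_iff)
    then show "a = c \<and> b = d"
    proof cases
      case 2
      have "a \<in> fst ` set es" "d \<in> snd ` set es"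
        using ab cd by force+
      with disj 2 show ?thesis by auto
    qed simp
  qed
  with \<open>distinct es\<close> show ?thesis
    by (simp add: doubles_def card_image distinct_card)
qed

lemma card_singles: "card (singles m n es) = m * n - 2 * length es"
proof -
  have "card (set (endpoints es)) = 2 * length es"
    using distinct_card[OF dist] by (simp add: endpoints_def)
  then show ?thesis
    by (simp add: singles_def card_Diff_subset[OF _ in_cells])
qed

lemma simple_grid: "simple_grid m n (singles m n es) (doubles es)"
proof -
  have "is_grid m n (singles m n es) (doubles es)"
    using endpoints_in_cells pair_neq by (auto simp: is_grid_def singles_def doubles_def)
  have edge: "e = {c, partner es c}"
    if e: "e \<in> selected_edges (singles m n es) (doubles es)" and "c \<in> e" for c e
  proof -
    consider "e = {c}" "c \<notin> set (endpoints es)" | a b where "(a, b) \<in> set es" "e = {a, b}"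
      using e \<open>c \<in> e\<close> by (auto simp: selected_edges_def singles_def doubles_def)
    then show ?thesis
    proof cases
      case 1
      then show ?thesis by (simp add: partner_outside)
    next
      case 2
      with \<open>c \<in> e\<close> show ?thesis
        using partner_inside[OF dist \<open>(a, b) \<in> set es\<close>] by auto
    qed
  qed
  have "e = f" if "e \<in> selected_edges (singles m n es) (doubles es)" "c \<in> e"
    "f \<in> selected_edges (singles m n es) (doubles es)" "c \<in> f" for c e f
    using edge[OF that(1,2)] edge[OF that(3,4)] by simp
  with \<open>is_grid m n (singles m n es) (doubles es)\<close> show ?thesis
    unfolding simple_grid_def by blast
qed

abbreviation I where "I \<equiv> identified m n (singles m n es) (doubles es)"
abbreviation Z where "Z \<equiv> certified m n (singles m n es) (doubles es)"

text \<open>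
  Identified pairs are always two-edges, because every rule that identifies a pair has this as a
  premise. Cells of distinct selected edges are distinct and do not form a two-edge, by simplicity.
\<close>

lemma RW3_plusI:
  assumes ident: "\<And>a b. (a, b) \<in> set es \<Longrightarrow> {a, b} \<in> I"
    and cert: "\<And>a b. \<lbrakk>a \<in> cells m n; b \<in> cells m n; a \<noteq> b; partner es a \<noteq> b\<rbrakk> \<Longrightarrow> {a, b} \<in> Z"
  shows "RW3_plus m n (singles m n es) (doubles es)"
proof -
  let ?E1 = "singles m n es" and ?E2 = "doubles es"
  have "p \<in> I \<Longrightarrow> p \<in> ?E2" for p
    by (induction rule: identified_certified.inducts(1)[where ?P2.0 = "\<lambda>_. True"]) auto
  moreover have "?E2 \<subseteq> I"
    using ident by (auto simp: doubles_def)
  moreover have "{a, b} \<in> Z"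
    if e: "e \<in> selected_edges ?E1 ?E2" "a \<in> e" and f: "f \<in> selected_edges ?E1 ?E2" "b \<in> f"
      and "e \<noteq> f" for e f a b
  proof -
    have cell: "a \<in> cells m n" "b \<in> cells m n"
      using e f simple_grid by (auto simp: simple_grid_def is_grid_def selected_edges_def)
    then have unique: "c \<in> {a, b} \<Longrightarrow> c \<in> g \<Longrightarrow> c \<in> h \<Longrightarrow> g \<in> selected_edges ?E1 ?E2 \<Longrightarrow>
        h \<in> selected_edges ?E1 ?E2 \<Longrightarrow> g = h" for c g h
      using simple_grid unfolding simple_grid_def by blast
    have "a \<noteq> b"
      using unique e f \<open>e \<noteq> f\<close> by blast
    moreover have "{a, b} \<notin> ?E2"
    proof
      assume "{a, b} \<in> ?E2"
      then have ab: "{a, b} \<in> selected_edges ?E1 ?E2"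
        by (simp add: selected_edges_def)
      have "e = {a, b}" by (rule unique[of a]) (use e ab in auto)
      moreover have "f = {a, b}" by (rule unique[of b]) (use f ab in auto)
      ultimately show False using \<open>e \<noteq> f\<close> by simp
    qed
    ultimately show ?thesis
      using cert cell by (simp add: doubles_iff)
  qed
  ultimately show ?thesis
    unfolding RW3_plus_def by blast
qed

end

section \<open>A bounded search for certificates of orthogonality\<close>

text \<open>
  The argument \<open>p\<close> is the involution of the whole matching and \<open>g\<close> its restriction to the two-edges known
  to be identified. The search succeeds on a line, and on a pair whose opposite diagonal is an
  identified two-edge. Otherwise it moves one of the four corners of the rectangle along \<open>g\<close>: first the
  two corners of the pair itself, then those of the opposite diagonal, unless that diagonal is a
  two-edge not known to be identified and thus blocks the transfer. Conditionals in place of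
  disjunctions make the simplifier stop at the first successful branch.
\<close>

fun reaches_line :: "(cell \<Rightarrow> cell) \<Rightarrow> (cell \<Rightarrow> cell) \<Rightarrow> nat \<Rightarrow> cell \<Rightarrow> cell \<Rightarrow> bool" where
  "reaches_line p g 0 (i, j) (k, l) \<longleftrightarrow> i = k \<or> j = l \<or> g (i, l) = (k, j)"
| "reaches_line p g (Suc d) (i, j) (k, l) \<longleftrightarrow>
     (if i = k \<or> j = l \<or> g (i, l) = (k, j) then True
      else if (if g (i, j) = (i, j) then False else reaches_line p g d (g (i, j)) (k, l)) then True
      else if (if g (k, l) = (k, l) then False else reaches_line p g d (i, j) (g (k, l))) then True
      else if p (i, l) = (k, j) then False
      else if (if g (i, l) = (i, l) then False else reaches_line p g d (g (i, l)) (k, j)) then True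
      else if g (k, j) = (k, j) then False else reaches_line p g d (i, l) (g (k, j)))"

lemmas reaches_line_one = reaches_line.simps(2)[where d = 0, folded One_nat_def]
lemmas reaches_line_numeral =
  reaches_line.simps(2)[where d = "pred_numeral v" for v, folded numeral_eq_Suc]

context disjoint_pairs
begin

definition glues :: "(cell \<Rightarrow> cell) \<Rightarrow> bool" where
  "glues g \<longleftrightarrow> (\<forall>c. g c = c \<or> (g c = partner es c \<and> {c, g c} \<in> I))"

lemma glues_partner:
  assumes "set fs \<subseteq> set es" "distinct (endpoints fs)"
    and "\<And>a b. (a, b) \<in> set fs \<Longrightarrow> {a, b} \<in> I"
  shows "glues (partner fs)"
  unfolding glues_def
proof
  fix c
  interpret fs: disjoint_pairs m n fs
  proof
    show "set (endpoints fs) \<subseteq> cells m n"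
      using assms(1) in_cells by (auto 0 3 simp only: endpoints_def set_append set_map)
  qed (rule assms(2))
  show "partner fs c = c \<or> (partner fs c = partner es c \<and> {c, partner fs c} \<in> I)"
  proof (rule fs.partner_cases[of c])
    assume "(c, partner fs c) \<in> set fs"
    then have "partner es c = partner fs c" "{c, partner fs c} \<in> I"
      using assms(1,3) partner_inside(1)[OF dist] by blast+
    then show ?thesis by simp
  next
    assume "(partner fs c, c) \<in> set fs"
    then have "partner es c = partner fs c" "{partner fs c, c} \<in> I"
      using assms(1,3) partner_inside(2)[OF dist] by blast+
    then show ?thesis by (simp add: insert_commute)
  qed simp
qed

lemma saturate:
  assumes "glues g" "g c \<noteq> c" "b \<notin> {c, g c}" "{g c, b} \<in> Z"
  shows "{c, b} \<in> Z"
proof (rule saturation)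
  show "{g c, c} \<in> I"
    using assms unfolding glues_def by (metis insert_commute)
qed (use assms in auto)

text \<open>
  Every success at depth \<open>0\<close> is an instance of the line rule or of a transfer from an identified
  two-edge, and every move is justified by saturation, followed by a transfer if the moved corner lies on
  the opposite diagonal. The hypotheses that the two cells are distinct and not partners are kept by the
  moves, because \<open>partner es\<close> is an involution.
\<close>

lemma certified_of_reaches_line:
  assumes "glues g" "reaches_line (partner es) g d a b"
    and "a \<in> cells m n" "b \<in> cells m n" "a \<noteq> b" "partner es a \<noteq> b"
  shows "{a, b} \<in> Z"
  using assms(2-)
proof (induction d arbitrary: a b)
  show *: "{a, b} \<in> Z"
    if "reaches_line (partner es) g 0 a b"
      and ab: "a \<in> cells m n" "b \<in> cells m n" "a \<noteq> b" "partner es a \<noteq> b" for a b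
  proof -
    obtain i j k l where eq: "a = (i, j)" "b = (k, l)" by (metis surj_pair)
    show ?thesis
    proof (cases "same_line a b")
      case True
      with ab show ?thesis
        by (intro line_certified) (auto simp: doubles_iff)
    next
      case False
      with that have g: "g (i, l) = (k, j)" "i \<noteq> k" "j \<noteq> l"
        by (auto simp: eq same_line_def)
      then have "{(i, l), (k, j)} \<in> I" "partner es (i, l) = (k, j)"
        using \<open>glues g\<close> by (metis glues_def prod.inject)+
      with g ab have "{(i, j), (k, l)} \<in> Z"
        by (intro transfer_certified[of m n i k l j])
           (auto simp: eq doubles_iff rectangle_def cells_def)
      then show ?thesis by (simp add: eq)
    qed
  qed
  case (Suc d)
  have gcell: "g c \<in> cells m n" and gpart: "g c \<noteq> c \<Longrightarrow> partner es (g c) = c \<and> g c = partner es c"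
    if "c \<in> cells m n" for c
    using \<open>glues g\<close> that partner_in_cells[OF that] partner_partner[of c] unfolding glues_def by metis+
  have slide: "{a, b} \<in> Z"
    if "g a \<noteq> a" "reaches_line (partner es) g d (g a) b"
      and ab: "a \<in> cells m n" "b \<in> cells m n" "a \<noteq> b" "partner es a \<noteq> b" for a b
  proof (rule saturate[OF \<open>glues g\<close>])
    show "{g a, b} \<in> Z"
      by (rule Suc.IH) (use that gcell[of a] gpart[of a] in auto)
  qed (use that gpart[of a] in auto)
  have slide': "{a, b} \<in> Z"
    if "g b \<noteq> b" "reaches_line (partner es) g d a (g b)"
      and ab: "a \<in> cells m n" "b \<in> cells m n" "a \<noteq> b" "partner es a \<noteq> b" for a b
  proof -
    have "g b \<noteq> a" "partner es a \<noteq> g b"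
      using that gpart[of b] partner_partner by metis+
    then have "{a, g b} \<in> Z"
      by (intro Suc.IH) (use that gcell[of b] in auto)
    then have "{b, a} \<in> Z"
      using saturate[OF \<open>glues g\<close> \<open>g b \<noteq> b\<close>, of a] \<open>a \<noteq> b\<close> \<open>g b \<noteq> a\<close> by (auto simp: insert_commute)
    then show ?thesis by (simp add: insert_commute)
  qed
  obtain i j k l where eq: "a = (i, j)" "b = (k, l)" by (metis surj_pair)
  show ?case
  proof (cases "reaches_line (partner es) g 0 a b")
    case True
    then show ?thesis using * Suc.prems by blast
  next
    case False
    have opp: "(i, l) \<in> cells m n" "(k, j) \<in> cells m n" "i \<noteq> k" "j \<noteq> l"
      using Suc.prems False by (auto simp: eq cells_def)
    consider "g a \<noteq> a" "reaches_line (partner es) g d (g a) b"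
      | "g b \<noteq> b" "reaches_line (partner es) g d a (g b)"
      | "partner es (i, l) \<noteq> (k, j)" "{(i, l), (k, j)} \<in> Z"
      using Suc.prems(1) False opp slide[of "(i, l)" "(k, j)"] slide'[of "(k, j)" "(i, l)"]
      by (auto simp: eq split: if_splits)
    then show ?thesis
    proof cases
      case 3
      then have "{(i, j), (k, l)} \<in> Z"
        using opp Suc.prems
        by (intro transfer_none[of m n i k l j]) (auto simp: eq doubles_iff rectangle_def cells_def)
      then show ?thesis by (simp add: eq)
    qed (use slide slide' Suc.prems in blast)+
  qed
qed

text \<open>A diagonal two-edge is identified as soon as the opposite diagonal is certified.\<close>

lemma identified_of_reaches_line:
  assumes "glues g" "((i, j), (k, l)) \<in> set es" "i \<noteq> k" "j \<noteq> l" "partner es (i, l) \<noteq> (k, j)"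
    and "reaches_line (partner es) g d (i, l) (k, j)"
  shows "{(i, j), (k, l)} \<in> I"
proof -
  have cell: "(i, j) \<in> cells m n" "(k, l) \<in> cells m n"
    using in_cells assms(2) by (force simp: endpoints_def)+
  then have "{(i, l), (k, j)} \<in> Z"
    using assms by (intro certified_of_reaches_line[of g d]) (auto simp: cells_def)
  with cell assms show ?thesis
    using partner_inside(1)[OF dist assms(2)]
    by (intro transfer_identified) (auto simp: doubles_iff rectangle_def cells_def)
qed

text \<open>The same for a whole list, in the shape in which the simplifier can evaluate the hypothesis.\<close>

lemma identified_of_list_reaches_line:
  assumes "glues g" "set fs \<subseteq> set es" "(a, b) \<in> set fs"
    and "list_all (\<lambda>((i, j), (k, l)). i \<noteq> k \<and> j \<noteq> l \<and> partner es (i, l) \<noteq> (k, j) \<and>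
      reaches_line (partner es) g d (i, l) (k, j)) fs"
  shows "{a, b} \<in> I"
proof -
  obtain i j k l where eq: "a = (i, j)" "b = (k, l)" by (metis surj_pair)
  with assms(3,4) have "i \<noteq> k" "j \<noteq> l" "partner es (i, l) \<noteq> (k, j)"
    "reaches_line (partner es) g d (i, l) (k, j)"
    by (auto simp: list_all_iff)
  with assms show ?thesis
    unfolding eq by (intro identified_of_reaches_line[of g]) auto
qed

text \<open>The two-edges that the line rule and the complementary-pair rule identify on their own.\<close>

lemma identified_on_line_or_complementary:
  assumes "((i, j), (k, l)) \<in> set es" "i = k \<or> j = l \<or> partner es (i, l) = (k, j)"
  shows "{(i, j), (k, l)} \<in> I"
proof -
  have cell: "(i, j) \<in> cells m n" "(k, l) \<in> cells m n"
    using in_cells assms(1) by (force simp: endpoints_def)+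
  have edge: "{(i, j), (k, l)} \<in> doubles es" "(i, j) \<noteq> (k, l)"
    using partner_inside(1)[OF dist assms(1)] pair_neq[OF assms(1)] by (auto simp: doubles_iff)
  show ?thesis
  proof (cases "i = k \<or> j = l")
    case True
    with cell edge show ?thesis
      by (intro line_identified) (auto simp: same_line_def)
  next
    case False
    with cell edge assms(2) show ?thesis
      by (intro complementary_pair) (auto simp: doubles_iff rectangle_def cells_def)
  qed
qed

end

section \<open>The extremal grid\<close>

text \<open>
  Row \<open>i\<close> stands for the edge \<open>{i, i + 1}\<close> of \<open>K\<^sub>6\<close>, row \<open>5 + i\<close> for \<open>{i, i + 2}\<close> and row \<open>10 + i\<close> for
  \<open>{i, 6}\<close>, where \<open>1 \<le> i \<le> 5\<close> and the vertices \<open>1, \<dots>, 5\<close> are read modulo \<open>5\<close>. The matching was found by a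
  computer search among those invariant under the rotation \<open>i \<mapsto> i + 1\<close>; each line of five pairs below
  is one orbit. The three lists are ordered by when their pairs are identified: at once (two orbits
  of complementary rectangles, then two orbits within rows), by gluing along \<open>immediate_pairs\<close>, and by
  gluing along the first two lists.
\<close>

definition immediate_pairs :: "(cell \<times> cell) list" where
  "immediate_pairs =
    [((1, 3), (10, 4)), ((2, 4), (6, 5)), ((3, 5), (7, 1)), ((4, 1), (8, 2)), ((5, 2), (9, 3)),
     ((1, 4), (10, 3)), ((2, 5), (6, 4)), ((3, 1), (7, 5)), ((4, 2), (8, 1)), ((5, 3), (9, 2)),
     ((6, 2), (6, 6)), ((7, 3), (7, 6)), ((8, 4), (8, 6)), ((9, 5), (9, 6)), ((10, 1), (10, 6)),
     ((11, 3), (11, 4)), ((12, 4), (12, 5)), ((13, 5), (13, 1)), ((14, 1), (14, 2)), ((15, 2), (15, 3))]"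

definition early_pairs :: "(cell \<times> cell) list" where
  "early_pairs =
    [((1, 5), (12, 3)), ((2, 1), (13, 4)), ((3, 2), (14, 5)), ((4, 3), (15, 1)), ((5, 4), (11, 2))]"

definition late_pairs :: "(cell \<times> cell) list" where
  "late_pairs =
    [((1, 6), (15, 4)), ((2, 6), (11, 5)), ((3, 6), (12, 1)), ((4, 6), (13, 2)), ((5, 6), (14, 3))]"

text \<open>The incidence matrix of \<open>K\<^sub>6\<close>, for the numbering of its edges just described.\<close>

definition ones :: "cell list" where
  "ones =
    [(1, 1), (1, 2), (2, 2), (2, 3), (3, 3), (3, 4), (4, 4), (4, 5), (5, 5), (5, 1),
     (6, 1), (6, 3), (7, 2), (7, 4), (8, 3), (8, 5), (9, 4), (9, 1), (10, 5), (10, 2),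
     (11, 1), (11, 6), (12, 2), (12, 6), (13, 3), (13, 6), (14, 4), (14, 6), (15, 5), (15, 6)]"

abbreviation all_pairs :: "(cell \<times> cell) list" where
  "all_pairs \<equiv> immediate_pairs @ early_pairs @ late_pairs"

lemmas pairs_defs = immediate_pairs_def early_pairs_def late_pairs_def

lemma distinct_cells: "distinct (endpoints all_pairs @ ones)"
  by (simp add: endpoints_def pairs_defs ones_def)

interpretation G: disjoint_pairs 15 6 all_pairs
proof
  show "distinct (endpoints all_pairs)"
    using distinct_cells by (simp del: append_assoc)
  show "set (endpoints all_pairs) \<subseteq> cells 15 6"
    by (simp add: endpoints_def pairs_defs cells_def)
qed

lemma length_all_pairs: "length all_pairs = 30"
  by (simp add: pairs_defs)

definition immediate_partner :: "cell \<Rightarrow> cell" where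
  "immediate_partner = partner immediate_pairs"

definition early_partner :: "cell \<Rightarrow> cell" where
  "early_partner = partner (immediate_pairs @ early_pairs)"

definition full_partner :: "cell \<Rightarrow> cell" where
  "full_partner = partner all_pairs"

text \<open>The same \<open>90\<close> cells, grouped so that \<open>partner_table\<close> applies to the shorter lists.\<close>

lemma distinct_cells_immediate: "distinct (endpoints immediate_pairs @ endpoints (early_pairs @ late_pairs) @ ones)"
  and distinct_cells_early: "distinct (endpoints (immediate_pairs @ early_pairs) @ endpoints late_pairs @ ones)"
  by (simp_all add: endpoints_def pairs_defs ones_def)

lemmas table_unfolds = endpoints_def pairs_defs ones_def append.simps list.map fst_conv snd_conv
  list.pred_inject prod.case simp_thms

lemmas immediate_table = partner_table[OF immediate_partner_def distinct_cells_immediate, unfolded table_unfolds]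
lemmas early_table = partner_table[OF early_partner_def distinct_cells_early, unfolded table_unfolds]
lemmas full_table = partner_table[OF full_partner_def distinct_cells, unfolded table_unfolds]

lemma singles_eq_ones: "singles 15 6 all_pairs = set ones"
proof (rule sym, rule card_subset_eq)
  have "set ones \<subseteq> cells 15 6"
    by (simp add: ones_def cells_def)
  then show "set ones \<subseteq> singles 15 6 all_pairs"
    using distinct_cells unfolding singles_def distinct_append by blast
  have "distinct ones"
    using distinct_cells unfolding distinct_append by blast
  then have "card (set ones) = 30"
    by (simp add: distinct_card ones_def)
  then show "card (set ones) = card (singles 15 6 all_pairs)"
    unfolding G.card_singles length_all_pairs by simp
qed (simp add: singles_def)

lemma no_rectangle_check:
  "list_all (\<lambda>(i, j). list_all (\<lambda>(k, l). i = k \<or> j = l \<or>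
     full_partner (i, l) \<noteq> (i, l) \<or> full_partner (k, j) \<noteq> (k, j)) ones) ones"
  unfolding ones_def
  \<comment> \<open>The table speaks of the numeral \<open>1\<close>; its rules would not match \<open>Suc 0\<close>.\<close>
  by (simp add: full_table del: One_nat_def)

lemma no_all_one_2x2_singles: "no_all_one_2x2 (singles 15 6 all_pairs)"
  unfolding no_all_one_2x2_def
proof clarify
  fix i k j l
  let ?E1 = "singles 15 6 all_pairs"
  assume "i \<noteq> k" "j \<noteq> l" and c: "(i, j) \<in> ?E1" "(i, l) \<in> ?E1" "(k, j) \<in> ?E1" "(k, l) \<in> ?E1"
  then have "full_partner (i, l) = (i, l)" "full_partner (k, j) = (k, j)"
    unfolding singles_def full_partner_def by (blast intro: partner_outside)+
  with \<open>i \<noteq> k\<close> \<open>j \<noteq> l\<close> c no_rectangle_check show False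
    unfolding singles_eq_ones list_all_iff by fast
qed

lemma zarankiewicz_15_6: "zarankiewicz 15 6 = 30"
proof -
  have "card (singles 15 6 all_pairs) = 30"
    unfolding G.card_singles length_all_pairs by simp
  moreover have "15 + (6 choose 2) = (30 :: nat)"
    by (simp add: choose_two)
  moreover have "singles 15 6 all_pairs \<subseteq> cells 15 6"
    by (simp add: singles_def)
  ultimately show ?thesis
    using zarankiewicz_eqI[OF _ no_all_one_2x2_singles] by metis
qed

lemma immediate_identified: "(a, b) \<in> set immediate_pairs \<Longrightarrow> {a, b} \<in> G.I"
proof -
  assume "(a, b) \<in> set immediate_pairs"
  moreover have "list_all (\<lambda>((i, j), (k, l)). i = k \<or> j = l \<or> full_partner (i, l) = (k, j)) immediate_pairs"
    unfolding immediate_pairs_def by (simp add: full_table del: One_nat_def)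
  ultimately show ?thesis
    unfolding full_partner_def
    by (cases a; cases b) (force simp: list_all_iff intro!: G.identified_on_line_or_complementary)
qed

lemma early_identified: "(a, b) \<in> set early_pairs \<Longrightarrow> {a, b} \<in> G.I"
proof (rule G.identified_of_list_reaches_line)
  show "G.glues immediate_partner"
    unfolding immediate_partner_def using distinct_cells_immediate immediate_identified
    by (intro G.glues_partner) auto
  have "list_all (\<lambda>((i, j), (k, l)). i \<noteq> k \<and> j \<noteq> l \<and> full_partner (i, l) \<noteq> (k, j) \<and>
      reaches_line full_partner immediate_partner 2 (i, l) (k, j)) early_pairs"
    unfolding early_pairs_def
    by (simp add: full_table immediate_table reaches_line_numeral reaches_line_one del: One_nat_def)
  then show "list_all (\<lambda>((i, j), (k, l)). i \<noteq> k \<and> j \<noteq> l \<and> partner all_pairs (i, l) \<noteq> (k, j) \<and>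
      reaches_line (partner all_pairs) immediate_partner 2 (i, l) (k, j)) early_pairs"
    unfolding full_partner_def .
qed auto

lemma late_identified: "(a, b) \<in> set late_pairs \<Longrightarrow> {a, b} \<in> G.I"
proof (rule G.identified_of_list_reaches_line)
  show "G.glues early_partner"
    unfolding early_partner_def using distinct_cells_early immediate_identified early_identified
    by (intro G.glues_partner) auto
  have "list_all (\<lambda>((i, j), (k, l)). i \<noteq> k \<and> j \<noteq> l \<and> full_partner (i, l) \<noteq> (k, j) \<and>
      reaches_line full_partner early_partner 3 (i, l) (k, j)) late_pairs"
    unfolding late_pairs_def
    by (simp add: full_table early_table reaches_line_numeral reaches_line_one del: One_nat_def)
  then show "list_all (\<lambda>((i, j), (k, l)). i \<noteq> k \<and> j \<noteq> l \<and> partner all_pairs (i, l) \<noteq> (k, j) \<and>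
      reaches_line (partner all_pairs) early_partner 3 (i, l) (k, j)) late_pairs"
    unfolding full_partner_def .
qed auto

abbreviation rows :: "nat list" where "rows \<equiv> [1, 2, 3, 4, 5, 6, 7, 8, 9, 10, 11, 12, 13, 14, 15]"
abbreviation cols :: "nat list" where "cols \<equiv> [1, 2, 3, 4, 5, 6]"

text \<open>The depth \<open>6\<close> is the largest number of gluings that any pair needs.\<close>

lemma all_reach_line:
  "list_all (\<lambda>i. list_all (\<lambda>k. i < k \<longrightarrow> list_all (\<lambda>j. list_all (\<lambda>l.
     full_partner (i, j) = (k, l) \<or> reaches_line full_partner full_partner 6 (i, j) (k, l)) cols) cols) rows) rows"
  by (simp add: full_table reaches_line_numeral reaches_line_one del: One_nat_def)

lemma certified_different_rows:
  assumes "(i, j) \<in> cells 15 6" "(k, l) \<in> cells 15 6" "i < k" "partner all_pairs (i, j) \<noteq> (k, l)"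
  shows "{(i, j), (k, l)} \<in> G.Z"
proof (rule G.certified_of_reaches_line)
  show "G.glues full_partner"
    unfolding full_partner_def using G.dist immediate_identified early_identified late_identified
    by (intro G.glues_partner) auto
  have "rows = [1..<16]" "cols = [1..<7]"
    by (simp_all add: upt_rec)
  moreover have "set [1..<16] = {1..15::nat}" "set [1..<7] = {1..6::nat}"
    by auto
  ultimately have "set rows = {1..15}" "set cols = {1..6}"
    by (simp_all only:)
  then have "i \<in> set rows" "k \<in> set rows" "j \<in> set cols" "l \<in> set cols"
    using assms by (simp_all only: cells_def mem_Sigma_iff)
  then have "full_partner (i, j) = (k, l) \<or> reaches_line full_partner full_partner 6 (i, j) (k, l)"
    using all_reach_line \<open>i < k\<close> unfolding list_all_iff by blast
  then show "reaches_line (partner all_pairs) full_partner 6 (i, j) (k, l)"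
    using assms by (simp add: full_partner_def)
qed (use assms in auto)

lemma RW3_plus_grid: "RW3_plus 15 6 (singles 15 6 all_pairs) (doubles all_pairs)"
proof (rule G.RW3_plusI)
  show "{a, b} \<in> G.I" if "(a, b) \<in> set all_pairs" for a b
    using that immediate_identified early_identified late_identified unfolding set_append by blast
  fix a b
  assume ab: "a \<in> cells 15 6" "b \<in> cells 15 6" "a \<noteq> b" "partner all_pairs a \<noteq> b"
  then have ba: "partner all_pairs b \<noteq> a"
    using G.partner_partner by metis
  obtain i j k l where eq: "a = (i, j)" "b = (k, l)" by (metis surj_pair)
  consider "i < k" | "k < i" | "i = k" by linarith
  then show "{a, b} \<in> G.Z"
  proof cases
    case 1
    with ab show ?thesis by (simp add: eq certified_different_rows)
  next
    case 2
    with ab ba have "{b, a} \<in> G.Z" by (simp add: eq certified_different_rows)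
    then show ?thesis by (simp add: insert_commute)
  next
    case 3
    with ab show ?thesis
      by (intro line_certified) (auto simp: eq same_line_def G.doubles_iff)
  qed
qed

theorem theorem3p1: "z_RL 15 6 = 60"
  unfolding z_RL_def
proof (rule Max_eqI)
  let ?A = "{card E1 + card E2 |E1 E2. simple_grid 15 6 E1 E2 \<and> limited 15 6 E1 \<and> RW3_plus 15 6 E1 E2}"
  show le: "t \<le> 60" if "t \<in> ?A" for t
    using that simple_grid_card_le[of 15 6] by (force simp: limited_def zarankiewicz_15_6)
  then have "?A \<subseteq> {..60}" by auto
  then show "finite ?A" by (rule finite_subset) simp
  have "card (singles 15 6 all_pairs) = 30" "card (doubles all_pairs) = 30"
    unfolding G.card_singles G.card_doubles length_all_pairs by simp_all
  moreover from this have "limited 15 6 (singles 15 6 all_pairs)"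
    by (simp add: limited_def zarankiewicz_15_6)
  moreover note G.simple_grid RW3_plus_grid
  ultimately show "60 \<in> ?A"
    by (intro CollectI exI[of _ "singles 15 6 all_pairs"] exI[of _ "doubles all_pairs"]) simp
qed

end
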